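(* Let $w=(w_j)$ be a positive non-increasing sequence with $w_1=1$, $\lim_{j\to\infty}w_j=0$ and $\sum_{j=1}^\infty w_j=\infty$. Then the Lorentz sequence space $d(w,1)$ does not have the W.A.P.
   Context: $d(w,1)$ is the Banach space of scalar sequences $x=(x_j)$ for which $\|x\|=\sum_{j=1}^\infty w_jx_j^*<\infty$, where $(x_j^* )$ is the non-increasing rearrangement of $(|x_j|)$. A Banach space $E$ has the weakly compact approximation property (W.A.P.) if there is a constant $C<\infty$ such that for every weakly compact set $D\subset E$ and every $\varepsilon>0$ there is a weakly compact operator $V:E\to E$ with $\sup_{x\in D}\|x-Vx\|<\varepsilon$ and $\|V\|\le C$. *)

theory Defs
  imports "HOL-Analysis.Analysis" "HOL-Library.Function_Algebras"
begin

text \<open>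
  The Lorentz space depends on the weight \<open>w\<close>, so it cannot be a type of class
  \<^class>\<open>banach\<close>. A normed space over the scalar field \<open>'k\<close> is given by a scalar
  multiplication \<open>s\<close>, a carrier set \<open>E\<close> and a norm \<open>N\<close>; every notion below depends only on
  the values of the maps and of \<open>N\<close> on the carrier.
\<close>

definition bounded_linear_on ::
  "('k \<Rightarrow> 'a \<Rightarrow> 'a) \<Rightarrow> 'a set \<Rightarrow> ('a \<Rightarrow> real) \<Rightarrow>
   ('k \<Rightarrow> 'b \<Rightarrow> 'b) \<Rightarrow> 'b set \<Rightarrow> ('b \<Rightarrow> real) \<Rightarrow>
   ('a::ab_group_add \<Rightarrow> 'b::ab_group_add) \<Rightarrow> bool" where
  "bounded_linear_on s E N s' F N' T \<longleftrightarrow>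
     T ` E \<subseteq> F \<and>
     (\<forall>x\<in>E. \<forall>y\<in>E. T (x + y) = T x + T y) \<and>
     (\<forall>c. \<forall>x\<in>E. T (s c x) = s' c (T x)) \<and>
     (\<exists>K. \<forall>x\<in>E. N' (T x) \<le> K * N x)"

definition dual_on ::
  "('k::real_normed_field \<Rightarrow> 'a \<Rightarrow> 'a) \<Rightarrow> 'a set \<Rightarrow> ('a \<Rightarrow> real) \<Rightarrow>
   ('a::ab_group_add \<Rightarrow> 'k) set" where
  "dual_on s E N = {f. bounded_linear_on s E N (*) UNIV norm f}"

definition weak_topology_on ::
  "('k::real_normed_field \<Rightarrow> 'a \<Rightarrow> 'a) \<Rightarrow> 'a set \<Rightarrow> ('a \<Rightarrow> real) \<Rightarrow>
   'a::ab_group_add topology" where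
  "weak_topology_on s E N =
     topology_generated_by {f -` U \<inter> E | f U. f \<in> dual_on s E N \<and> open U}"

lemma topspace_weak_topology_on:
  assumes "\<And>x. x \<in> E \<Longrightarrow> 0 \<le> N x"
  shows "topspace (weak_topology_on s E N) = E"
proof -
  have "(\<lambda>_. 0) \<in> dual_on s E N"
    using assms by (auto simp: dual_on_def bounded_linear_on_def intro!: exI[of _ 0])
  then have "E \<in> {f -` U \<inter> E | f U. f \<in> dual_on s E N \<and> open U}"
    by (auto intro!: exI[of _ "\<lambda>_. 0"] exI[of _ UNIV])
  then show ?thesis
    unfolding weak_topology_on_def topology_generated_by_topspace by auto
qed

definition weakly_compact_operator_on ::
  "('k::real_normed_field \<Rightarrow> 'a \<Rightarrow> 'a) \<Rightarrow> 'a set \<Rightarrow> ('a \<Rightarrow> real) \<Rightarrow>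
   ('a::ab_group_add \<Rightarrow> 'a) \<Rightarrow> bool" where
  "weakly_compact_operator_on s E N V \<longleftrightarrow>
     bounded_linear_on s E N s E N V \<and>
     compactin (weak_topology_on s E N)
       (weak_topology_on s E N closure_of (V ` {x \<in> E. N x \<le> 1}))"

definition opnorm_on :: "'a set \<Rightarrow> ('a \<Rightarrow> real) \<Rightarrow> ('a \<Rightarrow> 'a) \<Rightarrow> ennreal" where
  "opnorm_on E N V = (SUP x\<in>{x \<in> E. N x \<le> 1}. ennreal (N (V x)))"

text \<open>
  The suprema are taken in \<^typ>\<open>ennreal\<close>, so that the supremum over the empty set is \<open>0\<close>
  rather than an unspecified real.
\<close>

definition has_WAP ::
  "('k::real_normed_field \<Rightarrow> 'a \<Rightarrow> 'a) \<Rightarrow> 'a set \<Rightarrow> ('a::ab_group_add \<Rightarrow> real) \<Rightarrow> bool" where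
  "has_WAP s E N \<longleftrightarrow>
     (\<exists>C::real. \<forall>D. compactin (weak_topology_on s E N) D \<longrightarrow>
       (\<forall>\<epsilon>::real. \<epsilon> > 0 \<longrightarrow>
         (\<exists>V. weakly_compact_operator_on s E N V \<and>
              (SUP x\<in>D. ennreal (N (x - V x))) < ennreal \<epsilon> \<and>
              opnorm_on E N V \<le> ennreal C)))"

text \<open>
  The non-increasing rearrangement is given by the usual distribution-function formula, with
  indices starting at \<open>0\<close>. It is \<^typ>\<open>ennreal\<close>-valued because for an unbounded sequence no
  finite \<open>t\<close> qualifies.
\<close>

definition decr_rearr :: "(nat \<Rightarrow> 'k::real_normed_vector) \<Rightarrow> nat \<Rightarrow> ennreal" where
  "decr_rearr x n =
     Inf {t. finite {j. t < ennreal (norm (x j))} \<and> card {j. t < ennreal (norm (x j))} \<le> n}"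

lemma decr_rearr_eq:
  assumes "inj \<sigma>" "decseq (\<lambda>n. norm (x (\<sigma> n)))" "\<And>j. j \<notin> range \<sigma> \<Longrightarrow> x j = 0"
  shows "decr_rearr x n = ennreal (norm (x (\<sigma> n)))"
  unfolding decr_rearr_def
proof (rule antisym[OF Inf_lower Inf_greatest])
  let ?S = "\<lambda>t. {j. t < ennreal (norm (x j))}"
  have sub: "?S (ennreal (norm (x (\<sigma> n)))) \<subseteq> \<sigma> ` {..<n}"
  proof
    fix j assume j: "j \<in> ?S (ennreal (norm (x (\<sigma> n))))"
    then have lt: "norm (x (\<sigma> n)) < norm (x j)"
      by (auto simp: ennreal_less_iff)
    then have "x j \<noteq> 0" by auto
    then obtain k where k: "j = \<sigma> k" using assms(3) by blast
    have "\<not> n \<le> k"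
      using lt k decseqD[OF assms(2), of n k] by auto
    then show "j \<in> \<sigma> ` {..<n}" using k by auto
  qed
  have "card (?S (ennreal (norm (x (\<sigma> n))))) \<le> card (\<sigma> ` {..<n})"
    using sub by (intro card_mono) auto
  also have "\<dots> \<le> n" using card_image_le[of "{..<n}" \<sigma>] by auto
  finally show "ennreal (norm (x (\<sigma> n))) \<in> {t. finite (?S t) \<and> card (?S t) \<le> n}"
    using finite_subset[OF sub] by auto
next
  let ?S = "\<lambda>t. {j. t < ennreal (norm (x j))}"
  fix t assume t: "t \<in> {t. finite (?S t) \<and> card (?S t) \<le> n}"
  show "ennreal (norm (x (\<sigma> n))) \<le> t"
  proof (rule ccontr)
    assume "\<not> ?thesis"
    then have lt: "t < ennreal (norm (x (\<sigma> n)))" by simp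
    have "\<sigma> ` {..n} \<subseteq> ?S t"
    proof
      fix j assume "j \<in> \<sigma> ` {..n}"
      then obtain k where k: "k \<le> n" "j = \<sigma> k" by auto
      then have "ennreal (norm (x (\<sigma> n))) \<le> ennreal (norm (x j))"
        using assms(2) by (auto simp: decseq_def intro!: ennreal_leI)
      with lt show "j \<in> ?S t" by (simp add: less_le_trans del: ennreal_le_iff)
    qed
    then have "card (\<sigma> ` {..n}) \<le> n"
      using t card_mono[of "?S t" "\<sigma> ` {..n}"] by auto
    moreover have "card (\<sigma> ` {..n}) = Suc n"
      using assms(1) by (simp add: card_image inj_on_subset)
    ultimately show False by simp
  qed
qed

definition lorentz_sum :: "(nat \<Rightarrow> real) \<Rightarrow> (nat \<Rightarrow> 'k::real_normed_vector) \<Rightarrow> ennreal" where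
  "lorentz_sum w x = (\<Sum>j. ennreal (w j) * decr_rearr x j)"

definition lorentz_space :: "(nat \<Rightarrow> real) \<Rightarrow> (nat \<Rightarrow> 'k::real_normed_vector) set" where
  "lorentz_space w = {x. lorentz_sum w x < \<infinity>}"

definition lorentz_norm :: "(nat \<Rightarrow> real) \<Rightarrow> (nat \<Rightarrow> 'k::real_normed_vector) \<Rightarrow> real" where
  "lorentz_norm w x = enn2real (lorentz_sum w x)"

definition seq_scale :: "'k::times \<Rightarrow> (nat \<Rightarrow> 'k) \<Rightarrow> nat \<Rightarrow> 'k" where
  "seq_scale c x = (\<lambda>j. c * x j)"

end

theory Submission
  imports Defs
begin

text \<open>
  Since \<open>w\<close> tends to \<open>0\<close>, the unit vectors \<open>e\<^sub>j\<close> are weakly null, so they form with \<open>0\<close> a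
  weakly compact set. Let \<open>V\<close> be bounded with \<open>\<parallel>e\<^sub>j - V e\<^sub>j\<parallel> < 1/4\<close> for all \<open>j\<close>. Put
  \<open>W n = w\<^sub>0 + \<dots> + w\<^sub>n\<^sub>-\<^sub>1\<close> and choose disjoint blocks \<open>A\<^sub>k\<close> of sizes \<open>n\<^sub>k\<close> such that
  \<open>W n\<^sub>k\<close> at least doubles. With \<open>b\<^sub>j = W n\<^sub>k / n\<^sub>k\<close> on \<open>A\<^sub>k\<close> one has
  \<open>\<Sum> b\<^sub>j \<bar>x\<^sub>j\<bar> \<le> 3 \<parallel>x\<parallel>\<close>, so the space maps boundedly into a weighted \<open>\<ell>\<^sub>1\<close>. Averaging over signs
  gives unit vectors \<open>u\<^sub>k = \<Sum>\<^bsub>A\<^sub>k\<^esub> \<theta>\<^sub>j e\<^sub>j / W n\<^sub>k\<close> and functionals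
  \<open>f\<^sub>k x = \<Sum>\<^bsub>A\<^sub>k\<^esub> \<theta>\<^sub>j b\<^sub>j x\<^sub>j\<close> with \<open>\<bar>f\<^sub>k (V u\<^sub>k)\<bar> \<ge> 3/4\<close>. By Rosenthal's disjointification lemma the
  off-diagonal terms are small along an infinite set \<open>M\<close>. The weakly open sets
  \<open>{z. \<bar>\<Sum>\<^bsub>k \<in> M, k \<ge> m\<^esub> f\<^sub>k z\<bar> < 1/2}\<close> cover the space, but \<open>V u\<^sub>l\<close> avoids all of
  those with \<open>m \<le> l\<close>; hence \<open>V\<close> is not weakly compact.
\<close>

section \<open>Disjointification and averaging over signs\<close>

text \<open>Descent on the number of multiples of \<open>\<delta>\<close> that bound the
  off-diagonal sums. The index set splits into infinitely many infinite pieces. Either one piece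
  already works, or every piece \<open>P p\<close> has a row \<open>l p\<close> with mass above
  \<open>\<delta>\<close> inside the piece, and along \<open>range l\<close> the bound drops by
  \<open>\<delta>\<close>.\<close>

lemma rosenthal_disjointification:
  fixes a :: "nat \<Rightarrow> nat \<Rightarrow> real"
  assumes "0 < \<delta>"
    and bound: "\<And>l F. finite F \<Longrightarrow> sum (a l) F \<le> C"
  obtains M where "infinite M" "\<And>l F. l \<in> M \<Longrightarrow> finite F \<Longrightarrow> F \<subseteq> M - {l} \<Longrightarrow> sum (a l) F \<le> \<delta>"
proof -
  define small where
    "small c M \<longleftrightarrow> (\<forall>l\<in>M. \<forall>F. finite F \<longrightarrow> F \<subseteq> M - {l} \<longrightarrow> sum (a l) F \<le> c)" for c M
  have step: "\<exists>M. infinite M \<and> small \<delta> M" if "infinite M" "small (real n * \<delta>) M" for n M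
    using that
  proof (induction n arbitrary: M)
    case 0
    then have "small \<delta> M"
      using \<open>0 < \<delta>\<close> unfolding small_def by fastforce
    with 0 show ?case by blast
  next
    case (Suc n)
    define e where "e = enumerate M"
    have e_inj: "inj e" and e_in: "e i \<in> M" for i
      using Suc.prems(1) enumerate_in_set
      unfolding e_def by (auto simp: strict_mono_enumerate strict_mono_imp_inj_on)
    define P where "P p = range (\<lambda>i. e (prod_encode (p, i)))" for p
    have P_sub: "P p \<subseteq> M" for p
      using e_in by (auto simp: P_def)
    have P_inf: "infinite (P p)" for p
      unfolding P_def
      by (rule range_inj_infinite) (auto simp: inj_on_def dest!: injD[OF e_inj])
    have P_disj: "x \<notin> P q" if "x \<in> P p" "p \<noteq> q" for x p q
      using that by (auto simp: P_def dest!: injD[OF e_inj])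
    show ?case
    proof (cases "\<exists>p. small \<delta> (P p)")
      case True
      then show ?thesis using P_inf by blast
    next
      case False
      then have "\<forall>p. \<exists>l F. l \<in> P p \<and> finite F \<and> F \<subseteq> P p - {l} \<and> \<delta> < sum (a l) F"
        unfolding small_def by (meson not_le)
      then obtain l F where lF: "\<And>p. l p \<in> P p" "\<And>p. finite (F p)"
          "\<And>p. F p \<subseteq> P p - {l p}" "\<And>p. \<delta> < sum (a (l p)) (F p)"
        by metis
      \<comment> \<open>Along one representative per \<open>P p\<close>, the mass \<open>\<delta>\<close> carried by \<open>F p\<close> is lost.\<close>
      have "inj l"
        using lF(1) P_disj unfolding inj_def by metis
      then have inf: "infinite (range l)"
        by (rule range_inj_infinite)
      have "sum (a (l p)) G \<le> real n * \<delta>" if G: "finite G" "G \<subseteq> range l - {l p}" for p G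
      proof -
        \<comment> \<open>\<open>range l\<close> meets the piece \<open>P p\<close> only at
          \<open>l p\<close>, a point that both sets omit.\<close>
        have disj: "G \<inter> F p = {}"
        proof (rule equals0I)
          fix x assume "x \<in> G \<inter> F p"
          then obtain q where "x = l q" "x \<noteq> l p" "x \<in> P p"
            using G(2) lF(3)[of p] by auto
          then show False
            using lF(1)[of q] P_disj by (cases "q = p") auto
        qed
        have "G \<union> F p \<subseteq> M - {l p}"
          using G(2) lF(1) lF(3)[of p] P_sub by fastforce
        then have "sum (a (l p)) (G \<union> F p) \<le> real (Suc n) * \<delta>"
          using Suc.prems(2) lF(1)[of p] P_sub[of p] G(1) lF(2)[of p] unfolding small_def
          by (meson finite_UnI subsetD)
        then show ?thesis
          using lF(4)[of p] by (simp add: sum.union_disjoint[OF G(1) lF(2) disj] algebra_simps)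
      qed
      then have "small (real n * \<delta>) (range l)"
        unfolding small_def by blast
      then show ?thesis
        using Suc.IH inf by blast
    qed
  qed
  obtain n :: nat where "C \<le> real n * \<delta>"
    using reals_Archimedean3[OF \<open>0 < \<delta>\<close>] by (meson less_imp_le)
  then have "small (real n * \<delta>) UNIV"
    using bound unfolding small_def by (meson order_trans)
  with step[OF infinite_UNIV_nat] obtain M where "infinite M" "small \<delta> M"
    by blast
  then show thesis
    by (intro that[of M]) (simp_all add: small_def)
qed

text \<open>
  The trace is the average of the quadratic form over all signs. The summand \<open>c\<close> only serves the
  induction.
\<close>
lemma exists_signs_quadratic_form_ge_trace:
  fixes m :: "'i \<Rightarrow> 'i \<Rightarrow> 'k::real_normed_field"
  assumes "finite A"
  shows "\<exists>\<theta>. (\<forall>i. \<theta> i = 1 \<or> \<theta> i = -1) \<and>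
    norm ((\<Sum>i\<in>A. m i i) + c) \<le> norm ((\<Sum>i\<in>A. \<Sum>j\<in>A. \<theta> i * \<theta> j * m i j) + c)"
  using assms
proof (induction A arbitrary: c rule: finite_induct)
  case empty
  then show ?case by (auto intro: exI[of _ "\<lambda>_. 1"])
next
  case (insert p A)
  obtain \<theta> where \<theta>: "\<And>i. \<theta> i = 1 \<or> \<theta> i = -1"
    and le: "norm ((\<Sum>i\<in>A. m i i) + (m p p + c))
      \<le> norm ((\<Sum>i\<in>A. \<Sum>j\<in>A. \<theta> i * \<theta> j * m i j) + (m p p + c))"
    using insert.IH[of "m p p + c"] by blast
  define X where "X = (\<Sum>i\<in>A. \<Sum>j\<in>A. \<theta> i * \<theta> j * m i j) + (m p p + c)"
  \<comment> \<open>\<open>R\<close> collects the cross terms, which are linear in the new sign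
    \<open>s\<close>; since \<open>s * s = 1\<close>, the extended form is \<open>X + s * R\<close>.
    The two choices of \<open>s\<close> average to \<open>X\<close>, so one of them has norm at
    least \<open>norm X\<close>.\<close>
  define R where "R = (\<Sum>i\<in>A. \<theta> i * m i p) + (\<Sum>j\<in>A. \<theta> j * m p j)"
  have "2 * norm X = norm ((X + R) + (X - R))"
  proof -
    have "(X + R) + (X - R) = 2 * X"
      by (simp only: mult_2) (simp add: algebra_simps)
    then show ?thesis by (simp only: norm_mult norm_numeral)
  qed
  also have "\<dots> \<le> norm (X + R) + norm (X - R)"
    by (rule norm_triangle_ineq)
  finally have "norm X \<le> norm (X + R) \<or> norm X \<le> norm (X - R)"
    by linarith
  then obtain s where s: "s = 1 \<or> s = -1" "norm X \<le> norm (X + s * R)"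
  proof
    assume "norm X \<le> norm (X + R)"
    then show ?thesis using that[of 1] by simp
  next
    assume "norm X \<le> norm (X - R)"
    then show ?thesis using that[of "-1"] by simp
  qed
  define \<theta>' where "\<theta>' = \<theta>(p := s)"
  have [simp]: "\<theta>' i = \<theta> i" if "i \<in> A" for i
    using that insert.hyps by (auto simp: \<theta>'_def)
  have [simp]: "\<theta>' p = s" by (simp add: \<theta>'_def)
  have ss: "s * s = 1" using s(1) by auto
  have "(\<Sum>i\<in>insert p A. \<Sum>j\<in>insert p A. \<theta>' i * \<theta>' j * m i j) + c
      = s * s * m p p + (\<Sum>j\<in>A. s * \<theta> j * m p j)
        + (\<Sum>i\<in>A. \<theta> i * s * m i p + (\<Sum>j\<in>A. \<theta> i * \<theta> j * m i j)) + c"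
    using insert.hyps by simp
  also have "\<dots> = X + s * R"
    unfolding X_def R_def ss sum.distrib
    by (simp add: sum_distrib_left algebra_simps)
  finally have eq: "(\<Sum>i\<in>insert p A. \<Sum>j\<in>insert p A. \<theta>' i * \<theta>' j * m i j) + c = X + s * R" .
  have "(\<Sum>i\<in>insert p A. m i i) + c = (\<Sum>i\<in>A. m i i) + (m p p + c)"
    using insert.hyps by (simp add: algebra_simps)
  then have "norm ((\<Sum>i\<in>insert p A. m i i) + c) \<le> norm X"
    using le by (simp only: X_def)
  then have "norm ((\<Sum>i\<in>insert p A. m i i) + c)
      \<le> norm ((\<Sum>i\<in>insert p A. \<Sum>j\<in>insert p A. \<theta>' i * \<theta>' j * m i j) + c)"
    unfolding eq using s(2) by linarith
  moreover have "\<forall>i. \<theta>' i = 1 \<or> \<theta>' i = -1"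
    using \<theta> s(1) by (simp add: \<theta>'_def)
  ultimately show ?case by blast
qed

section \<open>Sorting and Abel summation\<close>

text \<open>Induction on the cardinality, with a minimiser of \<open>f\<close> placed last. It
  serves to sort finitely many coordinates by modulus.\<close>

lemma exists_decreasing_enumeration:
  fixes f :: "'a \<Rightarrow> real"
  assumes "finite F"
  shows "\<exists>\<sigma>. bij_betw \<sigma> {..<card F} F \<and> (\<forall>i j. i \<le> j \<longrightarrow> j < card F \<longrightarrow> f (\<sigma> j) \<le> f (\<sigma> i))"
  using assms
proof (induction "card F" arbitrary: F)
  case 0
  then show ?case by (auto simp: bij_betw_def)
next
  case (Suc n)
  then have "F \<noteq> {}" by auto
  define p where "p = arg_min_on f F"
  have p: "p \<in> F" "\<And>x. x \<in> F \<Longrightarrow> f p \<le> f x"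
    using arg_min_if_finite(1)[OF Suc.prems \<open>F \<noteq> {}\<close>, of f] arg_min_least[OF Suc.prems \<open>F \<noteq> {}\<close>]
    by (auto simp: p_def)
  have card: "card (F - {p}) = n"
    using Suc p by simp
  with Suc obtain \<sigma> where bij: "bij_betw \<sigma> {..<n} (F - {p})"
    and dec: "\<And>i j. i \<le> j \<Longrightarrow> j < n \<Longrightarrow> f (\<sigma> j) \<le> f (\<sigma> i)"
    by (metis finite_Diff)
  define \<tau> where "\<tau> = \<sigma>(n := p)"
  have "bij_betw \<tau> {..<n} (F - {p})"
    using bij by (subst bij_betw_cong[of _ _ \<sigma>]) (auto simp: \<tau>_def)
  then have "bij_betw \<tau> ({..<n} \<union> {n}) (F - {p} \<union> {p})"
    by (rule bij_betw_combine) (auto simp: \<tau>_def)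
  moreover have "{..<n} \<union> {n} = {..<card F}"
    using Suc.hyps(2) by auto
  moreover have "F - {p} \<union> {p} = F"
    using p by auto
  ultimately have bij': "bij_betw \<tau> {..<card F} F" by simp
  have "f (\<tau> j) \<le> f (\<tau> i)" if "i \<le> j" "j < card F" for i j
  proof (cases "j = n")
    case True
    have "\<tau> i \<in> F"
      using bij' that by (auto simp: bij_betw_def)
    then show ?thesis using True p by (simp add: \<tau>_def)
  next
    case False
    then show ?thesis
      using that dec Suc.hyps(2) by (simp add: \<tau>_def)
  qed
  with bij' show ?case by blast
qed

text \<open>Abel summation, in a form that avoids the explicit summation by parts: the induction
  shows that the weighted sum dominates the last coefficient times the plain partial sum of
  \<open>d\<close>.\<close>

lemma sum_mult_decreasing_nonneg:
  fixes a d :: "nat \<Rightarrow> real"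
  assumes "\<And>i j. i \<le> j \<Longrightarrow> j < m \<Longrightarrow> a j \<le> a i"
    and "\<And>i. i < m \<Longrightarrow> 0 \<le> a i"
    and "\<And>k. k \<le> m \<Longrightarrow> 0 \<le> sum d {..<k}"
  shows "0 \<le> (\<Sum>i<m. a i * d i)"
proof -
  have "a k * sum d {..<Suc k} \<le> (\<Sum>i<Suc k. a i * d i)" if "k < m" for k
    using that
  proof (induction k)
    case 0
    then show ?case by simp
  next
    case (Suc k)
    have "a (Suc k) * sum d {..<Suc k} \<le> a k * sum d {..<Suc k}"
      using assms(1)[of k "Suc k"] assms(3)[of "Suc k"] Suc.prems by (intro mult_right_mono) auto
    with Suc show ?case by (simp add: algebra_simps)
  qed
  moreover have "0 \<le> a k * sum d {..<Suc k}" if "k < m" for k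
    using assms(2)[OF that] assms(3)[of "Suc k"] that by (intro mult_nonneg_nonneg) auto
  ultimately have "0 \<le> (\<Sum>i<Suc k. a i * d i)" if "k < m" for k
    using that order_trans by blast
  then show ?thesis
    by (cases m) auto
qed

section \<open>The non-increasing rearrangement\<close>

definition unit_seq :: "nat \<Rightarrow> nat \<Rightarrow> 'k::zero_neq_one" where
  "unit_seq j = (\<lambda>i. if i = j then 1 else 0)"

definition seq_on :: "nat set \<Rightarrow> (nat \<Rightarrow> 'k::zero) \<Rightarrow> nat \<Rightarrow> 'k" where
  "seq_on A \<alpha> = (\<lambda>i. if i \<in> A then \<alpha> i else 0)"

text \<open>A level \<open>t\<close> below the value at \<open>\<sigma> i\<close> is exceeded at
  \<open>Suc i\<close> distinct indices, too many for \<open>t\<close> to enter the infimum. Only a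
  finite enumeration is involved, so the bound applies to every sequence.\<close>

lemma norm_le_decr_rearr:
  assumes inj: "inj_on \<sigma> {..i}"
    and dec: "\<And>k. k \<le> i \<Longrightarrow> norm (x (\<sigma> i)) \<le> norm (x (\<sigma> k))"
  shows "ennreal (norm (x (\<sigma> i))) \<le> decr_rearr x i"
  unfolding decr_rearr_def
proof (rule Inf_greatest, rule ccontr)
  fix t
  let ?S = "{j. t < ennreal (norm (x j))}"
  assume t: "t \<in> {t. finite {j. t < ennreal (norm (x j))} \<and> card {j. t < ennreal (norm (x j))} \<le> i}"
    and "\<not> ennreal (norm (x (\<sigma> i))) \<le> t"
  then have lt: "t < ennreal (norm (x (\<sigma> i)))" by simp
  have "\<sigma> ` {..i} \<subseteq> ?S"
    using lt dec by (auto intro: less_le_trans ennreal_leI)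
  then have "card (\<sigma> ` {..i}) \<le> i"
    using t card_mono[of ?S "\<sigma> ` {..i}"] by auto
  then show False
    using inj by (simp add: card_image)
qed

lemma decr_rearr_flat:
  assumes "finite A" "\<And>j. j \<in> A \<Longrightarrow> norm (\<alpha> j) = c"
  shows "decr_rearr (seq_on A \<alpha>) n = (if n < card A then ennreal c else 0)"
proof -
  have S: "{j. t < ennreal (norm (seq_on A \<alpha> j))} = (if t < ennreal c then A else {})" for t
    using assms(2) by (auto simp: seq_on_def)
  have "{t. finite {j. t < ennreal (norm (seq_on A \<alpha> j))} \<and> card {j. t < ennreal (norm (seq_on A \<alpha> j))} \<le> n}
      = (if n < card A then {ennreal c..} else UNIV)"
    unfolding S using assms(1) by (auto simp: not_less)
  then show ?thesis
    unfolding decr_rearr_def by (simp add: Inf_atLeast bot_ennreal)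
qed

text \<open>Passing from \<open>x\<close> to \<open>y\<close> adds at most the index
  \<open>p\<close> to each level set, so the rearrangement moves by at most one place.\<close>

lemma decr_rearr_insert_le:
  assumes "\<And>i. i \<noteq> p \<Longrightarrow> norm (y i) \<le> norm (x i)"
  shows "decr_rearr y (Suc n) \<le> decr_rearr x n"
  unfolding decr_rearr_def
proof (rule Inf_mono)
  fix t :: ennreal
  let ?X = "{j. t < ennreal (norm (x j))}" and ?Y = "{j. t < ennreal (norm (y j))}"
  assume "t \<in> {t. finite {j. t < ennreal (norm (x j))} \<and> card {j. t < ennreal (norm (x j))} \<le> n}"
  then have fin: "finite ?X" and card: "card ?X \<le> n"
    by auto
  have sub: "?Y \<subseteq> insert p ?X"
  proof
    fix j assume "j \<in> ?Y"
    then show "j \<in> insert p ?X"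
      using ennreal_leI[OF assms[of j]] by (cases "j = p") (auto intro: less_le_trans)
  qed
  then have "finite ?Y"
    using fin finite_subset by blast
  moreover have "card ?Y \<le> Suc n"
    using card_mono[OF _ sub] fin card card_insert_if[OF fin, of p] by (auto split: if_splits)
  ultimately show "\<exists>a\<in>{t. finite {j. t < ennreal (norm (y j))} \<and> card {j. t < ennreal (norm (y j))} \<le> Suc n}. a \<le> t"
    by blast
qed

section \<open>The weight and its partial sums\<close>

locale lorentz_weight =
  fixes w :: "nat \<Rightarrow> real"
  assumes w_pos: "\<And>j. 0 < w j"
    and w_decseq: "decseq w"
    and w_0: "w 0 = 1"
    and w_tendsto_0: "w \<longlonglongrightarrow> 0"
    and w_not_summable: "\<not> summable w"
begin

definition W :: "nat \<Rightarrow> real" where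
  "W n = sum w {..<n}"

lemma W_simps [simp]: "W 0 = 0" "W (Suc n) = W n + w n"
  by (simp_all add: W_def)

lemma W_mono: "m \<le> n \<Longrightarrow> W m \<le> W n"
  unfolding W_def using w_pos by (intro sum_mono2) (auto intro: less_imp_le)

lemma W_nonneg: "0 \<le> W n"
  using W_mono[of 0 n] by simp

lemma W_pos: "0 < n \<Longrightarrow> 0 < W n"
  unfolding W_def using w_pos by (intro sum_pos) auto

lemma W_ge_1: "0 < n \<Longrightarrow> 1 \<le> W n"
  using W_mono[of 1 n] w_0 by simp

lemma W_unbounded: "\<exists>n. B \<le> W n"
proof (rule ccontr)
  assume "\<not> (\<exists>n. B \<le> W n)"
  then have "sum w {..<n} \<le> B" for n
    unfolding W_def by (meson linear)
  then have "summable w"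
    using w_pos by (intro summableI_nonneg_bounded[of w B]) (auto intro: less_imp_le)
  with w_not_summable show False by simp
qed

text \<open>The next weight is at most the mean of its predecessors, so including it cannot raise
  the mean.\<close>

lemma W_mean_antimono:
  assumes "0 < m" "m \<le> n"
  shows "W n / n \<le> W m / m"
  using assms(2)
proof (induction n rule: dec_induct)
  case base
  show ?case by simp
next
  case (step n)
  have "real n * w n = (\<Sum>i<n. w n)" by simp
  also have "\<dots> \<le> W n"
    unfolding W_def using w_decseq by (intro sum_mono) (auto simp: decseq_def)
  finally have "W (Suc n) / Suc n \<le> W n / n"
    using assms(1) step.hyps by (simp add: divide_simps algebra_simps)
  with step.IH show ?case by simp
qed

text \<open>The means of a null sequence tend to 0: past \<open>m\<close> each weight is below
  \<open>\<delta> / 2\<close>, and \<open>k\<close> is taken so large that the fixed initial part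
  \<open>W m\<close> costs less than another \<open>\<delta> / 2 * k\<close>.\<close>

lemma W_mean_small:
  fixes \<delta> :: real
  assumes "0 < \<delta>"
  shows "\<exists>n>0. W n < \<delta> * n"
proof -
  obtain m where m: "\<And>j. m \<le> j \<Longrightarrow> w j < \<delta> / 2"
    using order_tendstoD(2)[OF w_tendsto_0, of "\<delta> / 2"] assms
    by (auto simp: eventually_sequentially)
  have bound: "W (m + k) \<le> W m + \<delta> / 2 * k" for k
  proof (induction k)
    case (Suc k)
    have "\<delta> / 2 * Suc k = \<delta> / 2 * k + \<delta> / 2"
      by (simp add: algebra_simps)
    moreover have "w (m + k) < \<delta> / 2"
      using m by simp
    ultimately show ?case
      unfolding add_Suc_right W_simps using Suc by linarith
  qed simp
  obtain k :: nat where k: "W m < real k * (\<delta> / 2)"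
    using reals_Archimedean3[of "\<delta> / 2"] assms by auto
  have "0 < k"
    using k W_nonneg[of m] by (cases k) auto
  moreover have "W (m + k) < \<delta> * real (m + k)"
  proof -
    have "\<delta> * real (m + k) = \<delta> * m + 2 * (\<delta> / 2 * k)"
      by (simp add: algebra_simps)
    moreover have "0 \<le> \<delta> * m"
      using assms by simp
    moreover have "W m < \<delta> / 2 * k"
      using k by (simp add: mult.commute)
    ultimately show ?thesis
      using bound[of k] by linarith
  qed
  ultimately show ?thesis
    by (intro exI[of _ "m + k"] conjI) simp_all
qed

section \<open>Estimates for the Lorentz norm\<close>

lemma lorentz_sum_flat:
  fixes \<alpha> :: "nat \<Rightarrow> 'k::real_normed_vector"
  assumes "finite A" "\<And>j. j \<in> A \<Longrightarrow> norm (\<alpha> j) = c" "0 \<le> c"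
  shows "lorentz_sum w (seq_on A \<alpha>) = ennreal (c * W (card A))"
proof -
  have "lorentz_sum w (seq_on A \<alpha>) = (\<Sum>j. if j \<in> {..<card A} then ennreal (c * w j) else 0)"
    unfolding lorentz_sum_def
    using assms(3) w_pos
    by (intro arg_cong[of _ _ suminf] ext)
      (auto simp: decr_rearr_flat[OF assms(1,2)] ennreal_mult less_imp_le mult.commute)
  also have "\<dots> = (\<Sum>j<card A. ennreal (c * w j))"
    by (subst suminf_finite[of "{..<card A}"]) (auto intro!: sum.cong)
  also have "\<dots> = ennreal (c * W (card A))"
    unfolding W_def sum_distrib_left using assms(3) w_pos
    by (intro sum_ennreal) (simp add: less_imp_le)
  finally show ?thesis .
qed

lemma seq_on_lorentz:
  fixes \<alpha> :: "nat \<Rightarrow> 'k::real_normed_vector"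
  assumes "finite A" "\<And>j. j \<in> A \<Longrightarrow> norm (\<alpha> j) = c" "0 \<le> c"
  shows "seq_on A \<alpha> \<in> lorentz_space w" "lorentz_norm w (seq_on A \<alpha>) = c * W (card A)"
  using lorentz_sum_flat[of A \<alpha>, OF assms] assms(3) W_nonneg
  by (simp_all add: lorentz_space_def lorentz_norm_def)

text \<open>The source of all bounded functionals below. With \<open>F\<close> sorted by decreasing
  modulus, the partial sums of \<open>C * w i - b (\<sigma> i)\<close> are nonnegative, so Abel
  summation replaces \<open>b\<close> by \<open>C * w\<close>; the sorted moduli are then dominated
  by the rearrangement of \<open>x\<close>.\<close>

lemma sum_weight_le_lorentz_norm:
  fixes x :: "nat \<Rightarrow> 'k::real_normed_vector"
  assumes x: "x \<in> lorentz_space w" and F: "finite F"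
    and b: "\<And>G. finite G \<Longrightarrow> sum b G \<le> C * W (card G)" and "0 \<le> C"
  shows "(\<Sum>j\<in>F. b j * norm (x j)) \<le> C * lorentz_norm w x"
proof -
  define m where "m = card F"
  obtain \<sigma> where bij: "bij_betw \<sigma> {..<m} F"
    and dec: "\<And>i j. i \<le> j \<Longrightarrow> j < m \<Longrightarrow> norm (x (\<sigma> j)) \<le> norm (x (\<sigma> i))"
    using exists_decreasing_enumeration[OF F, of "\<lambda>j. norm (x j)"] unfolding m_def by blast
  have inj: "inj_on \<sigma> {..<k}" if "k \<le> m" for k
    using bij that by (auto simp: bij_betw_def intro: inj_on_subset)
  have "0 \<le> (\<Sum>i<m. norm (x (\<sigma> i)) * (C * w i - b (\<sigma> i)))"
  proof (rule sum_mult_decreasing_nonneg)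
    fix k assume k: "k \<le> m"
    have "sum b (\<sigma> ` {..<k}) \<le> C * W k"
      using b[of "\<sigma> ` {..<k}"] card_image[OF inj[OF k]] by simp
    then show "0 \<le> (\<Sum>i<k. C * w i - b (\<sigma> i))"
      using inj[OF k] by (simp add: sum_subtractf sum.reindex W_def sum_distrib_left)
  qed (use dec in auto)
  then have "(\<Sum>i<m. b (\<sigma> i) * norm (x (\<sigma> i))) \<le> C * (\<Sum>i<m. w i * norm (x (\<sigma> i)))"
    by (simp add: sum_subtractf algebra_simps sum_distrib_left)
  moreover have "(\<Sum>i<m. b (\<sigma> i) * norm (x (\<sigma> i))) = (\<Sum>j\<in>F. b j * norm (x j))"
    by (rule sum.reindex_bij_betw[OF bij])
  moreover have "(\<Sum>i<m. w i * norm (x (\<sigma> i))) \<le> lorentz_norm w x"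
  proof -
    have "ennreal (\<Sum>i<m. w i * norm (x (\<sigma> i))) = (\<Sum>i<m. ennreal (w i) * ennreal (norm (x (\<sigma> i))))"
      using w_pos by (subst sum_ennreal[symmetric]) (auto simp: ennreal_mult'' less_imp_le)
    also have "\<dots> \<le> (\<Sum>i<m. ennreal (w i) * decr_rearr x i)"
    proof (intro sum_mono mult_left_mono norm_le_decr_rearr)
      fix i assume "i \<in> {..<m}"
      then show "inj_on \<sigma> {..i}"
        using inj[of "Suc i"] by (simp add: lessThan_Suc_atMost)
    qed (use dec in auto)
    also have "\<dots> \<le> lorentz_sum w x"
      unfolding lorentz_sum_def by (rule sum_le_suminf) auto
    also have "\<dots> = ennreal (lorentz_norm w x)"
      using x by (simp add: lorentz_space_def lorentz_norm_def)
    finally show ?thesis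
      by (simp add: lorentz_norm_def)
  qed
  ultimately show ?thesis
    using \<open>0 \<le> C\<close> by (smt (verit) mult_left_mono)
qed

lemma norm_coordinate_le_lorentz_norm:
  fixes x :: "nat \<Rightarrow> 'k::real_normed_vector"
  assumes "x \<in> lorentz_space w"
  shows "norm (x j) \<le> lorentz_norm w x"
proof -
  \<comment> \<open>The indicator of \<open>{j}\<close> is admissible with constant 1, because
    \<open>W n\<close> is at least \<open>w 0 = 1\<close> for positive \<open>n\<close>.\<close>
  have "sum (\<lambda>i. if i = j then 1 else 0) G \<le> 1 * W (card G)" if "finite G" for G
    using that W_ge_1[of "card G"] W_nonneg[of "card G"] by (auto simp: card_gt_0_iff)
  from sum_weight_le_lorentz_norm[OF assms _ this, of "{j}"] show ?thesis by simp
qed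

text \<open>The first term of the sum for \<open>y\<close> is finite since \<open>y\<close> is
  bounded; the later ones, shifted by one place, are dominated by the terms for \<open>x\<close>
  since the weight decreases. This will put \<open>e j - V (e j)\<close> in the space by comparison
  with \<open>V (e j)\<close>.\<close>

lemma lorentz_space_modify_coordinate:
  fixes x y :: "nat \<Rightarrow> 'k::real_normed_vector"
  assumes x: "x \<in> lorentz_space w" and eq: "\<And>i. i \<noteq> p \<Longrightarrow> norm (y i) \<le> norm (x i)"
  shows "y \<in> lorentz_space w"
proof -
  define B where "B = max (norm (y p)) (lorentz_norm w x)"
  have "norm (y i) \<le> B" for i
    using norm_coordinate_le_lorentz_norm[OF x, of i] eq[of i] by (cases "i = p") (auto simp: B_def)
  then have empty: "{j. ennreal B < ennreal (norm (y j))} = {}"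
    by (auto simp: not_less intro!: ennreal_leI)
  have "decr_rearr y 0 \<le> ennreal B"
    unfolding decr_rearr_def by (rule Inf_lower) (simp add: empty)
  then have 0: "ennreal (w 0) * decr_rearr y 0 < \<infinity>"
    by (simp add: w_0 le_less_trans)
  have "(\<Sum>j. ennreal (w (Suc j)) * decr_rearr y (Suc j)) \<le> lorentz_sum w x"
    unfolding lorentz_sum_def
  proof (intro suminf_le mult_mono decr_rearr_insert_le)
    show "ennreal (w (Suc n)) \<le> ennreal (w n)" for n
      using w_decseq by (intro ennreal_leI) (simp add: decseq_Suc_iff)
  qed (use eq in auto)
  also have "\<dots> < \<infinity>"
    using x by (simp add: lorentz_space_def)
  finally have "lorentz_sum w y < \<infinity>"
    unfolding lorentz_sum_def
    using 0 by (simp flip: sums_unique[OF sums_Suc[OF summable_sums[OF summableI]],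
          of "\<lambda>j. ennreal (w j) * decr_rearr y j"])
  then show ?thesis by (simp add: lorentz_space_def)
qed

section \<open>Blocks and the weighted sequence space\<close>

text \<open>The constant is 3 = 2 + 1: blocks of size at most \<open>card G\<close> contribute at
  most twice \<open>W (card G)\<close> by geometric growth, and the elements of \<open>G\<close>
  outside them contribute at most \<open>W (card G)\<close> because the mean weights
  decrease.\<close>

lemma exists_blocks:
  obtains A :: "nat \<Rightarrow> nat set" and b :: "nat \<Rightarrow> real" where
    "\<And>k. finite (A k)" "\<And>k. A k \<noteq> {}" "disjoint_family A"
    "\<And>j. 0 \<le> b j" "\<And>k j. j \<in> A k \<Longrightarrow> b j = W (card (A k)) / card (A k)"
    "\<And>G. finite G \<Longrightarrow> sum b G \<le> 3 * W (card G)"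
proof -
  have "\<exists>n. \<forall>k. 0 < n k \<and> 2 * W (n k) \<le> W (n (Suc k))"
  proof (rule dependent_nat_choice[where P = "\<lambda>_ m. 0 < m" and Q = "\<lambda>_ m n. 2 * W m \<le> W n"])
    fix m :: nat and k :: nat
    assume m: "0 < m"
    obtain n where "2 * W m \<le> W n" using W_unbounded by blast
    moreover from this have "0 < n" using W_pos[OF m] by (cases n) auto
    ultimately show "\<exists>n. 0 < n \<and> 2 * W m \<le> W n" by blast
  qed auto
  then obtain n :: "nat \<Rightarrow> nat" where n_pos: "\<And>k. 0 < n k"
    and n_double: "\<And>k. 2 * W (n k) \<le> W (n (Suc k))"
    by blast
  have n_mono: "mono n"
    unfolding mono_iff_le_Suc
  proof
    show "n k \<le> n (Suc k)" for k
      using n_double[of k] W_pos[OF n_pos[of k]] W_mono[of "n (Suc k)" "n k"] by linarith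
  qed
  have unbounded: "\<exists>k. m < n k" for m
  proof -
    have "real k \<le> W (n k)" for k
    proof (induction k)
      case (Suc k)
      then show ?case
        using n_double[of k] W_ge_1[OF n_pos[of k]] by simp
    qed (simp add: W_nonneg)
    moreover obtain k :: nat where "W m < k" using reals_Archimedean2 by blast
    ultimately have "W m < W (n k)" by (meson less_le_trans)
    then show ?thesis using W_mono[of "n k" m] by (meson not_le)
  qed
  define c where "c k = W (n k) / n k" for k
  \<comment> \<open>The pair coded by \<open>j\<close> consists of the block index and the position in the block.\<close>
  define A where "A k = prod_encode ` ({k} \<times> {..<n k})" for k
  define b where "b j = (case prod_decode j of (k, i) \<Rightarrow> if i < n k then c k else 0)" for j
  have card: "card (A k) = n k" for k
    unfolding A_def by (subst card_image) (auto simp: card_cartesian_product inj_on_def)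
  have c_nonneg: "0 \<le> c k" for k
    by (simp add: c_def W_nonneg)
  have c_antimono: "c l \<le> c k" if "k \<le> l" for k l
    unfolding c_def using n_pos monoD[OF n_mono that] by (rule W_mean_antimono)
  have b_nonneg: "0 \<le> b j" for j
    using c_nonneg by (auto simp: b_def split: prod.split)
  \<comment> \<open>Since \<open>W (n k)\<close> at least doubles, the sum is at most twice its last
    term.\<close>
  have initial: "(\<Sum>k<K. W (n k)) \<le> 2 * W m" if "\<And>k. k < K \<Longrightarrow> n k \<le> m" for K m
  proof (cases K)
    case 0
    then show ?thesis by (simp add: W_nonneg)
  next
    case (Suc L)
    have "(\<Sum>k<Suc k. W (n k)) \<le> 2 * W (n k)" for k
    proof (induction k)
      case 0
      show ?case by (simp add: W_nonneg)
    next
      case (Suc k)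
      then show ?case using n_double[of k] by simp
    qed
    then have "(\<Sum>k<K. W (n k)) \<le> 2 * W (n L)"
      unfolding Suc .
    also have "\<dots> \<le> 2 * W m"
      using W_mono[OF that[of L]] Suc by simp
    finally show ?thesis .
  qed
  have "sum b G \<le> 3 * W (card G)" if G: "finite G" for G
  proof (cases "G = {}")
    case False
    define m where "m = card G"
    have m: "0 < m" using G False by (simp add: m_def card_gt_0_iff)
    define K where "K = (LEAST k. m < n k)"
    have K: "m < n K" "\<And>k. k < K \<Longrightarrow> n k \<le> m"
      unfolding K_def by (rule LeastI_ex[OF unbounded], rule leI, rule not_less_Least)
    define G1 where "G1 = {j \<in> G. fst (prod_decode j) < K}"
    define S where "S = prod_encode ` (SIGMA k:{..<K}. {..<n k})"
    \<comment> \<open>\<open>b\<close> vanishes outside the blocks, so only the codes in the first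
      \<open>K\<close> blocks count.\<close>
    have "sum b G1 = sum b (G1 \<inter> S)"
    proof (rule sum.mono_neutral_right)
      show "\<forall>j\<in>G1 - G1 \<inter> S. b j = 0"
      proof
        fix j assume j: "j \<in> G1 - G1 \<inter> S"
        obtain k i where ki: "prod_decode j = (k, i)" by fastforce
        then have "j = prod_encode (k, i)" by (metis prod_decode_inverse)
        with j ki have "\<not> i < n k"
          by (auto simp: G1_def S_def)
        with ki show "b j = 0" by (simp add: b_def)
      qed
    qed (use G in \<open>auto simp: G1_def\<close>)
    also have "\<dots> \<le> sum b S"
      using b_nonneg by (intro sum_mono2) (auto simp: S_def)
    also have "\<dots> = (\<Sum>k<K. \<Sum>i<n k. b (prod_encode (k, i)))"
      unfolding S_def by (subst sum.reindex) (auto simp: inj_on_def sum.Sigma)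
    also have "\<dots> = (\<Sum>k<K. W (n k))"
    proof (rule sum.cong[OF refl])
      fix k
      have "(\<Sum>i<n k. b (prod_encode (k, i))) = (\<Sum>i<n k. c k)"
        by (rule sum.cong) (auto simp: b_def)
      then show "(\<Sum>i<n k. b (prod_encode (k, i))) = W (n k)"
        using n_pos[of k] by (simp add: c_def)
    qed
    also have "\<dots> \<le> 2 * W m"
      using initial K(2) by blast
    finally have 1: "sum b G1 \<le> 2 * W m" .
    \<comment> \<open>Block \<open>K\<close> is longer than \<open>m\<close>, so its mean
      \<open>c K\<close> is at most \<open>W m / m\<close>, and at most \<open>m\<close> indices are
      summed.\<close>
    have "sum b (G - G1) \<le> (\<Sum>j\<in>G - G1. c K)"
    proof (rule sum_mono)
      fix j assume "j \<in> G - G1"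
      then have "K \<le> fst (prod_decode j)" by (auto simp: G1_def)
      then show "b j \<le> c K"
        using c_antimono[of K] c_nonneg by (auto simp: b_def split: prod.split)
    qed
    also have "\<dots> \<le> real m * c K"
      using c_nonneg G card_mono[of G "G - G1"] by (auto simp: m_def intro!: mult_right_mono)
    also have "\<dots> \<le> real m * (W m / m)"
      unfolding c_def using W_mean_antimono[OF m, of "n K"] K(1) by (intro mult_left_mono) auto
    also have "\<dots> = W m" using m by simp
    finally have "sum b (G - G1) \<le> W m" .
    moreover have "sum b G = sum b (G - G1) + sum b G1"
      using G by (intro sum.subset_diff) (auto simp: G1_def)
    ultimately show ?thesis
      using 1 by (simp add: m_def)
  qed simp
  then show thesis
  proof (rule that[of A b, rotated -1])
    show "finite (A k)" "A k \<noteq> {}" for k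
      using n_pos[of k] by (auto simp: A_def)
    show "disjoint_family A"
      by (auto simp: disjoint_family_on_def A_def)
    show "b j = W (card (A k)) / card (A k)" if "j \<in> A k" for j k
      unfolding card using that by (auto simp: b_def A_def c_def)
  qed (simp_all add: b_nonneg)
qed

section \<open>The unit vectors in the weak topology\<close>

lemma unit_seq_eq_seq_on: "unit_seq j = seq_on {j} (\<lambda>_. 1)"
  by (auto simp: unit_seq_def seq_on_def)

lemma unit_seq_lorentz: "(unit_seq j :: nat \<Rightarrow> 'k::real_normed_field) \<in> lorentz_space w"
  unfolding unit_seq_eq_seq_on by (rule seq_on_lorentz(1)[of _ _ 1]) auto

lemma zero_lorentz: "(0 :: nat \<Rightarrow> 'k::real_normed_vector) \<in> lorentz_space w"
proof -
  have "(0 :: nat \<Rightarrow> 'k) = seq_on {} (\<lambda>_. 0)"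
    by (auto simp: seq_on_def)
  then show ?thesis
    using seq_on_lorentz(1)[of "{}" "\<lambda>_. 0 :: 'k" 0] by simp
qed

lemma lorentz_norm_nonneg: "0 \<le> lorentz_norm w x"
  by (simp add: lorentz_norm_def)

text \<open>The common modulus \<open>c\<close> keeps every partial sequence of the induction within
  reach of \<open>seq_on_lorentz\<close>, so additivity on the carrier applies.\<close>

lemma bounded_linear_on_seq_on:
  fixes T :: "(nat \<Rightarrow> 'k::real_normed_field) \<Rightarrow> 'b::ab_group_add"
  assumes T: "bounded_linear_on seq_scale (lorentz_space w) N s F N' T"
    and "finite A" "\<And>j. j \<in> A \<Longrightarrow> norm (\<alpha> j) = c" "0 \<le> c"
  shows "T (seq_on A \<alpha>) = (\<Sum>j\<in>A. s (\<alpha> j) (T (unit_seq j)))"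
  using assms(2,3)
proof (induction A rule: finite_induct)
  case empty
  have "seq_on {} \<alpha> = 0"
    by (auto simp: seq_on_def)
  moreover have "T (0 + 0) = T 0 + T 0"
    using T zero_lorentz unfolding bounded_linear_on_def by blast
  then have "T 0 = 0" by simp
  ultimately show ?case by (simp only: sum.empty)
next
  case (insert p A)
  have scale: "seq_on {p} \<alpha> = seq_scale (\<alpha> p) (unit_seq p)"
    by (auto simp: seq_on_def seq_scale_def unit_seq_def)
  have "seq_on A \<alpha> \<in> lorentz_space w" "seq_on {p} \<alpha> \<in> lorentz_space w"
    using insert \<open>0 \<le> c\<close> by (auto intro!: seq_on_lorentz(1)[of _ _ c])
  moreover have "seq_on (insert p A) \<alpha> = seq_on A \<alpha> + seq_on {p} \<alpha>"
    using insert.hyps by (auto simp: seq_on_def)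
  ultimately have "T (seq_on (insert p A) \<alpha>) = T (seq_on A \<alpha>) + T (seq_scale (\<alpha> p) (unit_seq p))"
    using T unfolding bounded_linear_on_def scale by simp
  also have "T (seq_scale (\<alpha> p) (unit_seq p)) = s (\<alpha> p) (T (unit_seq p))"
    using T unit_seq_lorentz unfolding bounded_linear_on_def by blast
  finally show ?case
    using insert by (simp add: add.commute)
qed

text \<open>If infinitely many values had modulus at least \<open>\<epsilon>\<close>, aligning the
  phases of \<open>n\<close> of them would give \<open>n * \<epsilon> \<le> K * W n\<close>, which
  fails for some \<open>n\<close> as the means of \<open>w\<close> tend to 0.\<close>

lemma dual_unit_seq_tendsto_0:
  fixes f :: "(nat \<Rightarrow> 'k::real_normed_field) \<Rightarrow> 'k"
  assumes "f \<in> dual_on seq_scale (lorentz_space w) (lorentz_norm w)"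
  shows "(\<lambda>j. f (unit_seq j)) \<longlonglongrightarrow> 0"
proof (rule ccontr)
  assume "\<not> ?thesis"
  then obtain \<epsilon> where "0 < \<epsilon>" and often: "\<And>m. \<exists>j\<ge>m. \<epsilon> \<le> norm (f (unit_seq j))"
    unfolding LIMSEQ_iff by (auto simp: not_less)
  define I where "I = {j. \<epsilon> \<le> norm (f (unit_seq j))}"
  have "infinite I"
    unfolding infinite_nat_iff_unbounded_le I_def using often by blast
  have f: "bounded_linear_on seq_scale (lorentz_space w) (lorentz_norm w) (*) UNIV norm f"
    using assms by (simp add: dual_on_def)
  then obtain K where K: "\<And>x. x \<in> lorentz_space w \<Longrightarrow> norm (f x) \<le> K * lorentz_norm w x"
    unfolding bounded_linear_on_def by blast
  \<comment> \<open>\<open>\<bar>K\<bar> + 1\<close> replaces \<open>K\<close>, whose sign is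
    unknown.\<close>
  have "0 < \<epsilon> / (\<bar>K\<bar> + 1)"
    using \<open>0 < \<epsilon>\<close> by simp
  then obtain n :: nat where n: "W n < \<epsilon> / (\<bar>K\<bar> + 1) * n"
    using W_mean_small by blast
  obtain A where A: "A \<subseteq> I" "finite A" "card A = n"
    using infinite_arbitrarily_large[OF \<open>infinite I\<close>] by blast
  define \<alpha> where "\<alpha> j = of_real (norm (f (unit_seq j))) / f (unit_seq j)" for j
  have \<alpha>: "norm (\<alpha> j) = 1" "\<alpha> j * f (unit_seq j) = of_real (norm (f (unit_seq j)))" if "j \<in> A" for j
  proof -
    have "f (unit_seq j) \<noteq> 0"
      using that A(1) \<open>0 < \<epsilon>\<close> by (auto simp: I_def)
    then show "norm (\<alpha> j) = 1" "\<alpha> j * f (unit_seq j) = of_real (norm (f (unit_seq j)))"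
      by (simp_all add: \<alpha>_def norm_divide)
  qed
  have "real n * \<epsilon> = (\<Sum>j\<in>A. \<epsilon>)"
    using A by simp
  also have "\<dots> \<le> (\<Sum>j\<in>A. norm (f (unit_seq j)))"
    using A(1) by (intro sum_mono) (auto simp: I_def)
  also have "\<dots> = norm (of_real (\<Sum>j\<in>A. norm (f (unit_seq j))) :: 'k)"
    by (simp add: sum_nonneg del: of_real_sum)
  also have "\<dots> = norm (f (seq_on A \<alpha>))"
    using bounded_linear_on_seq_on[OF f A(2), of \<alpha> 1] \<alpha> by simp
  also have "\<dots> \<le> K * W n"
    using K[OF seq_on_lorentz(1)[OF A(2)], of \<alpha> 1] seq_on_lorentz(2)[OF A(2), of \<alpha> 1] \<alpha>(1) A(3)
    by simp
  also have "\<dots> \<le> (\<bar>K\<bar> + 1) * W n"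
    using W_nonneg by (intro mult_right_mono) auto
  also have "\<dots> < real n * \<epsilon>"
    using n by (simp add: field_simps)
  finally show False by simp
qed

text \<open>Induction on the generation of weakly open sets reduces the claim to preimages under one
  functional \<open>f\<close>, where it says that \<open>f (unit_seq j)\<close> tends to
  \<open>f 0 = 0\<close>.\<close>

lemma unit_seq_weakly_null:
  "limitin (weak_topology_on seq_scale (lorentz_space w) (lorentz_norm w))
     (unit_seq :: nat \<Rightarrow> nat \<Rightarrow> 'k::real_normed_field) 0 sequentially"
  unfolding limitin_def topspace_weak_topology_on[OF lorentz_norm_nonneg]
proof (intro conjI allI impI zero_lorentz)
  fix U :: "(nat \<Rightarrow> 'k) set"
  let ?B = "{f -` U \<inter> lorentz_space w | f U.
    f \<in> dual_on seq_scale (lorentz_space w) (lorentz_norm w) \<and> open U} :: (nat \<Rightarrow> 'k) set set"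
  assume "openin (weak_topology_on seq_scale (lorentz_space w) (lorentz_norm w)) U \<and> 0 \<in> U"
  then have "generate_topology_on ?B U" "0 \<in> U"
    by (auto simp: weak_topology_on_def dest: openin_topology_generated_by)
  then show "\<forall>\<^sub>F j in sequentially. unit_seq j \<in> U"
  proof (induction rule: generate_topology_on.induct)
    case (UN S)
    then obtain O' where "O' \<in> S" "0 \<in> O'" by blast
    then have "\<forall>\<^sub>F j in sequentially. unit_seq j \<in> O'"
      by (rule UN.IH)
    then show ?case
      by (rule eventually_mono) (use \<open>O' \<in> S\<close> in blast)
  next
    case (Basis s)
    then obtain f O' where s: "s = f -` O' \<inter> lorentz_space w" "open O'"
      and f: "f \<in> dual_on seq_scale (lorentz_space w) (lorentz_norm w)"
      by blast
    have "f (0 + 0) = f 0 + f 0"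
      using f zero_lorentz unfolding dual_on_def bounded_linear_on_def by blast
    then have "f 0 = 0" by simp
    then have "0 \<in> O'"
      using Basis.prems unfolding s(1) by (simp only: vimage_eq Int_iff)
    then have "\<forall>\<^sub>F j in sequentially. f (unit_seq j) \<in> O'"
      using dual_unit_seq_tendsto_0[OF f] s(2) by (simp add: topological_tendstoD)
    then show ?case
      unfolding s by (auto simp: unit_seq_lorentz elim: eventually_mono)
  qed (auto intro: eventually_conj)
qed

lemma weakly_compact_unit_seq:
  "compactin (weak_topology_on seq_scale (lorentz_space w) (lorentz_norm w))
     (insert 0 (range (unit_seq :: nat \<Rightarrow> nat \<Rightarrow> 'k::real_normed_field)))"
  by (rule compactin_sequence_with_limit[OF unit_seq_weakly_null])
    (auto simp: topspace_weak_topology_on[OF lorentz_norm_nonneg] unit_seq_lorentz)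

section \<open>Functionals from a weighted l1 space\<close>

lemma weighted_summable:
  fixes x :: "nat \<Rightarrow> 'k::real_normed_vector"
  assumes "\<And>j. 0 \<le> b j" "\<And>G. finite G \<Longrightarrow> sum b G \<le> C * W (card G)" "0 \<le> C"
    and "x \<in> lorentz_space w"
  shows "summable (\<lambda>j. b j * norm (x j))" "(\<Sum>j. b j * norm (x j)) \<le> C * lorentz_norm w x"
proof -
  have le: "(\<Sum>j<n. b j * norm (x j)) \<le> C * lorentz_norm w x" for n
    using assms by (intro sum_weight_le_lorentz_norm) auto
  then show "summable (\<lambda>j. b j * norm (x j))"
    using assms(1) by (intro summableI_nonneg_bounded) auto
  then show "(\<Sum>j. b j * norm (x j)) \<le> C * lorentz_norm w x"
    using le by (rule suminf_le_const)
qed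

text \<open>The map into the weighted l1 space is followed by a multiplier bounded by 1.
  Completeness of the scalars turns absolute convergence into convergence.\<close>

lemma weighted_functional_dual:
  fixes \<phi> :: "nat \<Rightarrow> 'k::{real_normed_field,banach}"
  assumes b: "\<And>j. 0 \<le> b j" "\<And>G. finite G \<Longrightarrow> sum b G \<le> C * W (card G)" "0 \<le> C"
    and \<phi>: "\<And>j. norm (\<phi> j) \<le> 1"
  shows "x \<in> lorentz_space w \<Longrightarrow> summable (\<lambda>j. norm (\<phi> j * of_real (b j) * x j))"
    and "(\<lambda>x. \<Sum>j. \<phi> j * of_real (b j) * x j) \<in> dual_on seq_scale (lorentz_space w) (lorentz_norm w)"
proof -
  have le: "norm (\<phi> j * of_real (b j) * x j) \<le> b j * norm (x j)" for x :: "nat \<Rightarrow> 'k" and j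
  proof -
    have "norm (\<phi> j) * (b j * norm (x j)) \<le> 1 * (b j * norm (x j))"
      using \<phi> b(1) by (intro mult_right_mono) auto
    then show ?thesis
      using b(1)[of j] by (simp add: norm_mult mult.assoc)
  qed
  show sn: "summable (\<lambda>j. norm (\<phi> j * of_real (b j) * x j))" if "x \<in> lorentz_space w" for x :: "nat \<Rightarrow> 'k"
  proof (rule summable_comparison_test'[OF weighted_summable(1)[OF b that], of 0])
    show "norm (norm (\<phi> j * of_real (b j) * x j)) \<le> b j * norm (x j)" for j
      unfolding real_norm_def abs_norm_cancel by (rule le)
  qed
  note s = summable_norm_cancel[OF sn]
  have "(\<Sum>j. \<phi> j * of_real (b j) * (x + y) j)
      = (\<Sum>j. \<phi> j * of_real (b j) * x j) + (\<Sum>j. \<phi> j * of_real (b j) * y j)"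
    if "x \<in> lorentz_space w" "y \<in> lorentz_space w" for x y
    by (subst suminf_add[OF s[OF that(1)] s[OF that(2)]]) (simp add: algebra_simps)
  moreover have "(\<Sum>j. \<phi> j * of_real (b j) * seq_scale c x j) = c * (\<Sum>j. \<phi> j * of_real (b j) * x j)"
    if "x \<in> lorentz_space w" for c x
    by (subst suminf_mult[OF s[OF that], symmetric]) (simp add: seq_scale_def ac_simps)
  moreover have "norm (\<Sum>j. \<phi> j * of_real (b j) * x j) \<le> C * lorentz_norm w x"
    if "x \<in> lorentz_space w" for x
  proof -
    have "norm (\<Sum>j. \<phi> j * of_real (b j) * x j) \<le> (\<Sum>j. b j * norm (x j))"
      using le by (rule norm_suminf_le) (rule weighted_summable(1)[OF b that])
    then show ?thesis
      using weighted_summable(2)[OF b that] by simp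
  qed
  ultimately show "(\<lambda>x. \<Sum>j. \<phi> j * of_real (b j) * x j)
      \<in> dual_on seq_scale (lorentz_space w) (lorentz_norm w)"
    unfolding dual_on_def bounded_linear_on_def by (auto intro!: exI[of _ C])
qed

section \<open>Failure of the approximation property\<close>

lemma not_has_WAP:
  "\<not> has_WAP (seq_scale :: 'k::{real_normed_field,banach} \<Rightarrow> _) (lorentz_space w) (lorentz_norm w)"
proof
  let ?s = "seq_scale :: 'k \<Rightarrow> _" and ?E = "lorentz_space w :: (nat \<Rightarrow> 'k) set"
    and ?N = "lorentz_norm w :: (nat \<Rightarrow> 'k) \<Rightarrow> real"
  let ?X = "weak_topology_on ?s ?E ?N"
  assume "has_WAP ?s ?E ?N"
  \<comment> \<open>Closeness 1/4 leaves 3/4 on the diagonal; after an off-diagonal loss of 1/8 this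
    still exceeds the threshold 1/2.\<close>
  moreover have "0 < (1/4 :: real)" by simp
  ultimately obtain V where V: "weakly_compact_operator_on ?s ?E ?N V"
    and V_close: "(SUP x\<in>insert 0 (range unit_seq). ennreal (?N (x - V x))) < ennreal (1/4)"
    using weakly_compact_unit_seq[where 'k = 'k] unfolding has_WAP_def by blast
  have V_lin: "bounded_linear_on ?s ?E ?N ?s ?E ?N V"
    using V by (simp add: weakly_compact_operator_on_def)
  then have V_in: "V x \<in> ?E" if "x \<in> ?E" for x
    using that unfolding bounded_linear_on_def by blast
  obtain K where K: "?N (V x) \<le> K * ?N x" if "x \<in> ?E" for x
    using V_lin unfolding bounded_linear_on_def by blast
  define e where "e = (unit_seq :: nat \<Rightarrow> nat \<Rightarrow> 'k)"
  have diag_e: "norm (1 - V (e j) j) < 1/4" for j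
  proof -
    have "e j - V (e j) \<in> ?E"
    proof (rule lorentz_space_modify_coordinate[of "V (e j)" j])
      show "V (e j) \<in> ?E"
        unfolding e_def by (rule V_in[OF unit_seq_lorentz])
    qed (simp add: e_def unit_seq_def)
    then have "norm ((e j - V (e j)) j) \<le> ?N (e j - V (e j))"
      by (rule norm_coordinate_le_lorentz_norm)
    moreover have "ennreal (?N (e j - V (e j))) < ennreal (1/4)"
      using V_close by (rule le_less_trans[rotated], intro SUP_upper) (simp add: e_def)
    then have "?N (e j - V (e j)) < 1/4"
      by (simp add: ennreal_less_iff lorentz_norm_nonneg)
    ultimately have "norm ((e j - V (e j)) j) < 1/4"
      by linarith
    then show ?thesis
      by (simp add: e_def unit_seq_def)
  qed
  obtain A :: "nat \<Rightarrow> nat set" and b where A: "\<And>k. finite (A k)" "\<And>k. A k \<noteq> {}" "disjoint_family A"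
    and b_nonneg: "\<And>j. 0 \<le> b j"
    and b_eq: "\<And>k j. j \<in> A k \<Longrightarrow> b j = W (card (A k)) / card (A k)"
    and b_sum: "\<And>G. finite G \<Longrightarrow> sum b G \<le> 3 * W (card G)"
    by (rule exists_blocks) (rule that)
  note b = b_nonneg b_sum
  have "\<forall>k. \<exists>\<theta>. (\<forall>i. \<theta> i = 1 \<or> \<theta> i = -1) \<and> norm (\<Sum>i\<in>A k. V (e i) i)
      \<le> norm (\<Sum>i\<in>A k. \<Sum>j\<in>A k. \<theta> i * \<theta> j * V (e j) i)"
    using exists_signs_quadratic_form_ge_trace[OF A(1), where m = "\<lambda>i j. V (e j) i" and c = 0] by simp
  from choice[OF this] obtain \<theta> where \<theta>: "\<And>k i. \<theta> k i = 1 \<or> \<theta> k i = -1"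
    and \<theta>_trace: "\<And>k. norm (\<Sum>i\<in>A k. V (e i) i)
      \<le> norm (\<Sum>i\<in>A k. \<Sum>j\<in>A k. \<theta> k i * \<theta> k j * V (e j) i)"
    by blast
  have norm_\<theta>: "norm (\<theta> k i) = 1" for k i
    using \<theta>[of k i] by auto
  define n where "n k = card (A k)" for k
  have n_pos: "0 < n k" for k
    using A(1,2) by (simp add: n_def card_gt_0_iff)
  note Wn_pos = W_pos[OF n_pos]
  define u where "u k = seq_on (A k) (\<lambda>j. \<theta> k j / of_real (W (n k)))" for k
  have norm_coeff: "norm (\<theta> k j / of_real (W (n k))) = 1 / W (n k)" for k j
    using Wn_pos[of k] norm_\<theta> by (simp add: norm_divide)
  have u: "u k \<in> ?E" "?N (u k) = 1" for k
    using seq_on_lorentz[OF A(1) norm_coeff, of k k] Wn_pos[of k]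
    by (simp_all add: u_def n_def)
  define y where "y k = V (u k)" for k
  have y_in: "y k \<in> ?E" and y_norm: "?N (y k) \<le> K" for k
    using V_in[OF u(1)] K[OF u(1)] u(2) by (simp_all add: y_def)
  have sum_apply: "(\<Sum>j\<in>B. h j) i = (\<Sum>j\<in>B. h j i)" for B i and h :: "nat \<Rightarrow> nat \<Rightarrow> 'k"
    by (induction B rule: infinite_finite_induct) auto
  have y_coord: "y k i = (\<Sum>j\<in>A k. \<theta> k j / of_real (W (n k)) * V (e j) i)" for k i
    unfolding y_def u_def e_def
    by (subst bounded_linear_on_seq_on[OF V_lin A(1) norm_coeff])
      (use Wn_pos[of k] in \<open>simp_all add: sum_apply seq_scale_def\<close>)
  have diag: "3/4 \<le> norm (\<Sum>i\<in>A k. \<theta> k i * of_real (b i) * y k i)" for k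
  proof -
    \<comment> \<open>The factor \<open>W (n k)\<close> in \<open>b i\<close> cancels the
      normalisation of \<open>u k\<close>. What remains is the signed quadratic form of
      \<open>V\<close> on the block, divided by \<open>n k\<close>.\<close>
    have weighted: "\<theta> k i * of_real (b i) * y k i
        = (\<Sum>j\<in>A k. \<theta> k i * \<theta> k j * V (e j) i) / of_nat (n k)" if "i \<in> A k" for i
      unfolding y_coord sum_distrib_left sum_divide_distrib
      using b_eq[OF that] Wn_pos[of k] by (intro sum.cong) (simp_all add: n_def field_simps)
    have "real (n k) = norm (\<Sum>i\<in>A k. 1 :: 'k)"
      by (simp add: n_def)
    also have "\<dots> = norm ((\<Sum>i\<in>A k. V (e i) i) + (\<Sum>i\<in>A k. 1 - V (e i) i))"
      by (simp add: sum_subtractf)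
    also have "\<dots> \<le> norm (\<Sum>i\<in>A k. V (e i) i) + (\<Sum>i\<in>A k. norm (1 - V (e i) i))"
      by (intro order_trans[OF norm_triangle_ineq] add_left_mono norm_sum)
    also have "(\<Sum>i\<in>A k. norm (1 - V (e i) i)) \<le> (\<Sum>i\<in>A k. 1/4)"
      using diag_e by (intro sum_mono less_imp_le)
    also have "\<dots> = n k / 4"
      by (simp add: n_def)
    finally have "3/4 * n k \<le> norm (\<Sum>i\<in>A k. V (e i) i)"
      by simp
    also note \<theta>_trace
    also have "norm (\<Sum>i\<in>A k. \<Sum>j\<in>A k. \<theta> k i * \<theta> k j * V (e j) i)
        = n k * norm (\<Sum>i\<in>A k. \<theta> k i * of_real (b i) * y k i)"
      using n_pos[of k] weighted by (simp add: sum_divide_distrib[symmetric] norm_divide)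
    finally show ?thesis
      using n_pos[of k] by (simp add: mult.commute)
  qed
  \<comment> \<open>The mass of \<open>y l\<close> on block \<open>k\<close> in the weighted l1
    norm; its row sums are bounded because \<open>V\<close> is.\<close>
  define a where "a l k = (\<Sum>i\<in>A k. b i * norm (y l i))" for l k
  have a_sum: "sum (a l) F = (\<Sum>i\<in>(\<Union>k\<in>F. A k). b i * norm (y l i))" if "finite F" for l F
    unfolding a_def using that A(1,3)
    by (subst sum.UNION_disjoint) (auto simp: disjoint_family_on_def)
  have "sum (a l) F \<le> 3 * K" if "finite F" for l F
  proof -
    have "sum (a l) F \<le> 3 * ?N (y l)"
      unfolding a_sum[OF that] using that A(1) b by (intro sum_weight_le_lorentz_norm y_in) auto
    then show ?thesis using y_norm[of l] by simp
  qed
  then obtain M where M: "infinite M"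
    and offdiag: "\<And>l F. l \<in> M \<Longrightarrow> finite F \<Longrightarrow> F \<subseteq> M - {l} \<Longrightarrow> sum (a l) F \<le> 1/8"
    using rosenthal_disjointification[of "1/8" a "3 * K"] by auto
  define blk where "blk i = (THE k. i \<in> A k)" for i
  have blk: "blk i = k" if "i \<in> A k" for i k
    unfolding blk_def using that A(3) by (intro the_equality) (auto simp: disjoint_family_on_def)
  \<comment> \<open>Off the blocks \<open>blk i\<close> is unspecified, hence the guard
    \<open>i \<in> A (blk i)\<close>. The functional \<open>g m\<close> then sums the block
    functionals over the \<open>k\<close> in \<open>M\<close> with \<open>k \<ge> m\<close>.\<close>
  define \<phi> where "\<phi> m i = (if i \<in> A (blk i) \<and> blk i \<in> M \<and> m \<le> blk i then \<theta> (blk i) i else 0)" for m i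
  have norm_\<phi>: "norm (\<phi> m i) \<le> 1" for m i
    using norm_\<theta> by (simp add: \<phi>_def)
  define g where "g m z = (\<Sum>i. \<phi> m i * of_real (b i) * z i)" for m z
  have three: "0 \<le> (3::real)" by simp
  have g_summable: "summable (\<lambda>i. \<phi> m i * of_real (b i) * z i)" if "z \<in> ?E" for m z
    by (rule summable_norm_cancel, rule weighted_functional_dual(1)[OF b three norm_\<phi> that])
  define U where "U m = g m -` ball 0 (1/2) \<inter> ?E" for m
  have U_open: "openin ?X (U m)" for m
  proof -
    have "g m \<in> dual_on ?s ?E ?N"
      using weighted_functional_dual(2)[OF b three norm_\<phi>] by (simp add: g_def[abs_def])
    then show ?thesis
      unfolding weak_topology_on_def U_def by (intro topology_generated_by_Basis) auto
  qed
  have U_cover: "\<exists>m. z \<in> U m" if z: "z \<in> ?E" for z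
  proof -
    have s: "summable (\<lambda>i. b i * norm (z i))"
      using b three z by (rule weighted_summable(1))
    obtain J where J: "norm (\<Sum>i. b (i + J) * norm (z (i + J))) < 1/2"
      using suminf_exist_split[of "1/2", OF _ s] by auto
    \<comment> \<open>This exceeds the block index of every coordinate below \<open>J\<close>, so
      \<open>g m\<close> sees only the small tail of \<open>z\<close>.\<close>
    define m where "m = Suc (\<Sum>i<J. blk i)"
    have \<phi>_0: "\<phi> m i = 0" if "i < J" for i
      using member_le_sum[of i "{..<J}" blk] that by (auto simp: \<phi>_def m_def)
    have "g m z = (\<Sum>i. \<phi> m (i + J) * of_real (b (i + J)) * z (i + J))"
      unfolding g_def
      by (subst suminf_split_initial_segment[OF g_summable[OF z], of _ J])
        (simp add: \<phi>_0)
    also have "norm \<dots> \<le> (\<Sum>i. b (i + J) * norm (z (i + J)))"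
    proof (rule norm_suminf_le)
      fix i
      have "norm (\<phi> m (i + J)) * (b (i + J) * norm (z (i + J))) \<le> 1 * (b (i + J) * norm (z (i + J)))"
        using norm_\<phi> b(1) by (intro mult_right_mono) auto
      then show "norm (\<phi> m (i + J) * of_real (b (i + J)) * z (i + J)) \<le> b (i + J) * norm (z (i + J))"
        using b(1)[of "i + J"] by (simp add: norm_mult mult.assoc)
    next
      show "summable (\<lambda>i. b (i + J) * norm (z (i + J)))"
        using s by (rule summable_ignore_initial_segment)
    qed
    finally have "norm (g m z) < 1/2"
      using J by simp
    then show ?thesis
      using z by (auto simp: U_def)
  qed
  have y_notin_U: "y l \<notin> U m" if l: "l \<in> M" "m \<le> l" for l m
  proof -
    define h where "h i = \<phi> m i * of_real (b i) * y l i" for i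
    \<comment> \<open>\<open>r\<close> is the part of \<open>h\<close> off block \<open>l\<close>.
      It lives on other blocks of \<open>M\<close>, where the disjointification bounds it by
      1/8.\<close>
    define r where "r i = (if i \<in> A l then 0 else h i)" for i
    have h_summable: "summable h"
      unfolding h_def by (rule g_summable[OF y_in])
    have head: "(\<lambda>i. if i \<in> A l then h i else 0) sums sum h (A l)"
      using A(1) by (rule sums_If_finite_set)
    have "(\<lambda>i. h i - (if i \<in> A l then h i else 0)) sums (suminf h - sum h (A l))"
      using h_summable head by (intro sums_diff summable_sums)
    moreover have "(\<lambda>i. h i - (if i \<in> A l then h i else 0)) = r"
      by (auto simp: r_def)
    ultimately have r_sums: "r sums (suminf h - sum h (A l))"
      by simp
    have r_le: "norm (\<Sum>i<J. r i) \<le> 1/8" for J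
    proof -
      define S where "S = {i \<in> {..<J}. r i \<noteq> 0}"
      have S: "i \<in> A (blk i)" "blk i \<in> M - {l}" if "i \<in> S" for i
        using that by (auto simp: S_def r_def h_def \<phi>_def split: if_splits)
      have "norm (\<Sum>i<J. r i) = norm (sum r S)"
        unfolding S_def by (intro arg_cong[of _ _ norm] sum.mono_neutral_right) auto
      also have "\<dots> \<le> (\<Sum>i\<in>S. norm (r i))"
        by (rule norm_sum)
      also have "\<dots> \<le> (\<Sum>i\<in>S. b i * norm (y l i))"
      proof (rule sum_mono)
        fix i
        have "norm (\<phi> m i) * (b i * norm (y l i)) \<le> 1 * (b i * norm (y l i))"
          using norm_\<phi> b(1) by (intro mult_right_mono) auto
        then show "norm (r i) \<le> b i * norm (y l i)"
          using b(1)[of i] by (simp add: r_def h_def norm_mult mult.assoc)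
      qed
      also have "\<dots> \<le> (\<Sum>i\<in>(\<Union>k\<in>blk ` S. A k). b i * norm (y l i))"
        using S(1) A(1) b(1) by (intro sum_mono2) (auto simp: S_def)
      also have "\<dots> = sum (a l) (blk ` S)"
        by (rule a_sum[symmetric]) (simp add: S_def)
      also have "\<dots> \<le> 1/8"
        using S(2) l(1) by (intro offdiag) (auto simp: S_def)
      finally show ?thesis .
    qed
    have "norm (suminf h - sum h (A l)) \<le> 1/8"
      using r_sums r_le unfolding sums_def
      by (intro Lim_bounded[OF tendsto_norm, of _ _ 0]) auto
    moreover have "sum h (A l) = (\<Sum>i\<in>A l. \<theta> l i * of_real (b i) * y l i)"
      using l blk by (intro sum.cong) (auto simp: h_def \<phi>_def)
    then have "3/4 \<le> norm (sum h (A l))"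
      using diag[of l] by simp
    moreover have "norm (sum h (A l)) \<le> norm (suminf h) + norm (suminf h - sum h (A l))"
      by (metis norm_minus_commute norm_triangle_sub)
    ultimately have "1/2 \<le> norm (suminf h)"
      by linarith
    then show ?thesis
      by (simp add: U_def g_def h_def[abs_def])
  qed
  let ?C = "?X closure_of (V ` {x \<in> ?E. ?N x \<le> 1})"
  have top: "topspace ?X = ?E"
    by (rule topspace_weak_topology_on) (rule lorentz_norm_nonneg)
  have "compactin ?X ?C"
    using V by (simp add: weakly_compact_operator_on_def)
  then have "\<exists>\<F>. finite \<F> \<and> \<F> \<subseteq> range U \<and> ?C \<subseteq> \<Union>\<F>"
  proof (rule compactinD)
    show "openin ?X B" if "B \<in> range U" for B
      using that U_open by blast
    show "?C \<subseteq> \<Union>(range U)"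
      using U_cover closure_of_subset_topspace[of ?X] unfolding top by blast
  qed
  then obtain \<F> where \<F>: "finite \<F>" "\<F> \<subseteq> range U" "?C \<subseteq> \<Union>\<F>"
    by blast
  then obtain T where T: "finite T" "\<F> = U ` T"
    by (meson finite_subset_image)
  \<comment> \<open>The sum of the finite set \<open>T\<close> bounds each of its elements, so
    \<open>y l\<close> avoids every set of the subcover.\<close>
  obtain l where l: "l \<in> M" "sum id T \<le> l"
    using M unfolding infinite_nat_iff_unbounded_le by blast
  have "V ` {x \<in> ?E. ?N x \<le> 1} \<subseteq> ?C"
    using V_in by (intro closure_of_subset) (auto simp: top)
  then have "y l \<in> ?C"
    using u[of l] unfolding y_def by auto
  then obtain m where "m \<in> T" "y l \<in> U m"
    using \<F>(3) T(2) by auto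
  moreover have "m \<le> l" if "m \<in> T" for m
    using member_le_sum[of m T id] that T(1) l(2) by simp
  ultimately show False
    using y_notin_U[OF l(1)] by blast
qed

end

theorem mainTheorem8:
  fixes w :: "nat \<Rightarrow> real"
  assumes "\<And>j. 0 < w j"
    and "decseq w"
    and "w 0 = 1"
    and "w \<longlonglongrightarrow> 0"
    and "\<not> summable w"
  shows "\<not> has_WAP (seq_scale :: real \<Rightarrow> _) (lorentz_space w) (lorentz_norm w)
       \<and> \<not> has_WAP (seq_scale :: complex \<Rightarrow> _) (lorentz_space w) (lorentz_norm w)"
proof -
  interpret lorentz_weight w
    using assms by unfold_locales
  show ?thesis
    by (intro conjI not_has_WAP)
qed

end
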